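(* Let $\varepsilon,W>0$ and let $\{[N_t,I]\}_{t\ge 0}$ be a sequence of $(\varepsilon,W)$-regular, unimodular random networks related by generalized majority dynamics, where $N_t=(G,w,X_t)$. Then $$\mathbb{P}\left[\lim_{t\to\infty}\big(X_{t+2}(I)-X_t(I)\big)=0\right]=1,$$ and furthermore $$\mathbb{E}\left[\#\{t\ge 0 : X_{t+2}(I)\neq X_t(I)\}\right]\le\frac{2W}{\varepsilon}.$$
   Context: Graphs $G=(V,E)$ are finite or countably infinite, locally finite and undirected. $\partial(i)$ denotes the set of neighbors of $i$; $i$ itself is allowed to belong to $\partial(i)$ (in which case $(i,i)$ carries a weight, which is allowed to be positive); apart from this, graphs are simple. A network is a triplet $N=(G,w,X)$ with $G=(V,E)$ a graph, $X:V\to\{-1,+1\}$ a labeling of vertices, and $w:E\to\mathbb{R}^+$ a weighting of the (undirected) edges, so $w(i,j)=w(j,i)$. A rooted network is a pair $(N,i)$ with $i\in V$; a directed edge rooted network is a triplet $(N,i,j)$ with $(i,j)\in E$. An isomorphism of rooted networks $(N,i)\to(N',i')$ is a graph isomorphism $h:G\to G'$ with $h(i)=i'$, $X=X'\circ h$ and $w=w'\circ h$ ($h$ extended to edges); isomorphisms of directed edge rooted networks are defined similarly (preserving the directed root edge). $[N,i]$ and $[N,i,j]$ denote isomorphism classes. $\mathcal{G}_\bullet$ is the set of isomorphism classes of connected rooted networks and $\mathcal{G}_{\bullet\bullet}$ that of directed edge rooted networks, equipped with the natural (local, Benjamini–Schramm) topology of convergence of finite balls around the root (with their labels and weights), and the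 corresponding Borel structure. A random network $[N,I]$ is a $\mathcal{G}_\bullet$-valued random variable. It is unimodular if for every Borel $f:\mathcal{G}_{\bullet\bullet}\to[0,\infty]$, $$\mathbb{E}\Big[\sum_{j\in\partial(I)}f(N,I,j)\Big]=\mathbb{E}\Big[\sum_{j\in\partial(I)}f(N,j,I)\Big].$$ A sequence of random networks $[N_t,I]$, $t\in\{0,1,2,\dots\}$, is related by generalized majority dynamics if, starting from a random network $[N_0,I]=[G,w,X_0,I]$, one has for $t>0$ $[N_t,I]=[G,w,X_t,I]$, with the same (random) graph, weights and root for all $t$, and $$X_t(i)=\mathrm{sgn}\sum_{j\in\partial(i)}X_{t-1}(j)\,w(i,j)\quad\text{for all } i\in V,$$ where $w$ is assumed to be such that almost surely no ties occur (the sum is never zero). For $W,\varepsilon>0$, a random network $[N,I]$ (more precisely, its weights $w$) is $(\varepsilon,W)$-regular if $$\mathbb{E}\Big[\sum_{j\in\partial(I)}w(I,j)\Big]\le W$$ and, almost surely, $$\min_{x\in\{-1,+1\}^{\partial(I)}}\Big|\sum_{j\in\partial(I)}x_j\,w(I,j)\Big|\ge\varepsilon.$$ *)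

theory Defs
  imports "HOL-Probability.Probability"
begin

text \<open>Networks are finite or countably infinite, so up to isomorphism their vertices may be taken
  to be natural numbers. An undirected edge is stored in both orientations; loops are allowed.
  The values of \<open>weight\<close> off the edge set and of \<open>label\<close> off the vertex set are irrelevant.\<close>

record network =
  verts :: "nat set"
  edges :: "(nat \<times> nat) set"
  weight :: "nat \<Rightarrow> nat \<Rightarrow> real"
  label :: "nat \<Rightarrow> real"

definition nbrs :: "network \<Rightarrow> nat \<Rightarrow> nat set" where
  "nbrs N i = {j. (i, j) \<in> edges N}"

definition is_network :: "network \<Rightarrow> bool" where
  "is_network N \<longleftrightarrow>
     edges N \<subseteq> verts N \<times> verts N \<and> sym (edges N) \<and>
     (\<forall>i\<in>verts N. finite (nbrs N i)) \<and>
     (\<forall>i\<in>verts N. label N i \<in> {-1, 1}) \<and>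
     (\<forall>(i, j)\<in>edges N. 0 \<le> weight N i j \<and> weight N i j = weight N j i)"

definition connected_network :: "network \<Rightarrow> bool" where
  "connected_network N \<longleftrightarrow>
     is_network N \<and> (\<forall>u\<in>verts N. \<forall>v\<in>verts N. (u, v) \<in> (edges N)\<^sup>*)"

text \<open>Root data are lists of vertices, so that both kinds of rooted networks are treated at once:
  \<open>(N, [i])\<close> is a rooted network and \<open>(N, [i, j])\<close> a directed edge rooted network.\<close>

definition isomorphic :: "network \<times> nat list \<Rightarrow> network \<times> nat list \<Rightarrow> bool" where
  "isomorphic = (\<lambda>(N, rs) (N', rs'). \<exists>h.
     bij_betw h (verts N) (verts N') \<and>
     (\<forall>u\<in>verts N. \<forall>v\<in>verts N. (u, v) \<in> edges N \<longleftrightarrow> (h u, h v) \<in> edges N') \<and>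
     (\<forall>v\<in>verts N. label N' (h v) = label N v) \<and>
     (\<forall>(u, v)\<in>edges N. weight N' (h u) (h v) = weight N u v) \<and>
     map h rs = rs')"

type_synonym net_class = "(network \<times> nat list) set"

definition iso_class :: "network \<Rightarrow> nat list \<Rightarrow> net_class" where
  "iso_class N rs = {(N', rs'). connected_network N' \<and> isomorphic (N, rs) (N', rs')}"

definition rooted_classes :: "net_class set" where
  "rooted_classes = {iso_class N [i] | N i. connected_network N \<and> i \<in> verts N}"

definition edge_rooted_classes :: "net_class set" where
  "edge_rooted_classes = {iso_class N [i, j] | N i j. connected_network N \<and> (i, j) \<in> edges N}"

text \<open>The set of vertices at graph distance at most \<open>r\<close> from \<open>S\<close>.\<close>

primrec graph_ball :: "network \<Rightarrow> nat set \<Rightarrow> nat \<Rightarrow> nat set" where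
  "graph_ball N S 0 = S"
| "graph_ball N S (Suc r) = graph_ball N S r \<union> (\<Union>v\<in>graph_ball N S r. nbrs N v)"

text \<open>The induced \<open>r\<close>-balls around the roots are isomorphic as labeled rooted graphs, by an
  isomorphism changing each edge weight by less than \<open>\<delta>\<close>.\<close>

definition ball_close ::
  "nat \<Rightarrow> real \<Rightarrow> network \<times> nat list \<Rightarrow> network \<times> nat list \<Rightarrow> bool" where
  "ball_close r \<delta> = (\<lambda>(N, rs) (N', rs'). \<exists>h.
     bij_betw h (graph_ball N (set rs) r) (graph_ball N' (set rs') r) \<and>
     (\<forall>u\<in>graph_ball N (set rs) r. \<forall>v\<in>graph_ball N (set rs) r.
        ((u, v) \<in> edges N \<longleftrightarrow> (h u, h v) \<in> edges N') \<and>
        ((u, v) \<in> edges N \<longrightarrow> \<bar>weight N' (h u) (h v) - weight N u v\<bar> < \<delta>)) \<and>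
     (\<forall>v\<in>graph_ball N (set rs) r. label N' (h v) = label N v) \<and>
     map h rs = rs')"

definition local_nbhd :: "net_class set \<Rightarrow> net_class \<Rightarrow> nat \<Rightarrow> real \<Rightarrow> net_class set" where
  "local_nbhd K c r \<delta> = {c' \<in> K. \<exists>x\<in>c. \<exists>x'\<in>c'. ball_close r \<delta> x x'}"

definition local_topology :: "net_class set \<Rightarrow> net_class topology" where
  "local_topology K = topology_generated_by {local_nbhd K c r \<delta> | c r \<delta>. c \<in> K \<and> 0 < \<delta>}"

definition local_borel :: "net_class set \<Rightarrow> net_class measure" where
  "local_borel K = sigma K {U. openin (local_topology K) U}"

text \<open>Evaluates an isomorphism-invariant function \<open>\<phi>\<close> of a network and its (first) root on an
  isomorphism class, by means of an arbitrary representative. It is only applied to invariant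
  functions, for which the choice of the representative is immaterial.\<close>

definition on_class :: "(network \<Rightarrow> nat \<Rightarrow> 'b) \<Rightarrow> net_class \<Rightarrow> 'b" where
  "on_class \<phi> c = (case (SOME x. x \<in> c) of (N, rs) \<Rightarrow> \<phi> N (hd rs))"

definition root_label :: "net_class \<Rightarrow> real" where
  "root_label = on_class label"

definition random_network :: "'a measure \<Rightarrow> ('a \<Rightarrow> net_class) \<Rightarrow> bool" where
  "random_network M Z \<longleftrightarrow> prob_space M \<and> Z \<in> measurable M (local_borel rooted_classes)"

definition unimodular :: "'a measure \<Rightarrow> ('a \<Rightarrow> net_class) \<Rightarrow> bool" where
  "unimodular M Z \<longleftrightarrow>
     (\<forall>f :: net_class \<Rightarrow> ennreal. f \<in> borel_measurable (local_borel edge_rooted_classes) \<longrightarrow>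
       (\<integral>\<^sup>+ \<omega>. on_class (\<lambda>N i. \<Sum>j\<in>nbrs N i. f (iso_class N [i, j])) (Z \<omega>) \<partial>M) =
       (\<integral>\<^sup>+ \<omega>. on_class (\<lambda>N i. \<Sum>j\<in>nbrs N i. f (iso_class N [j, i])) (Z \<omega>) \<partial>M))"

definition regular_network :: "real \<Rightarrow> real \<Rightarrow> 'a measure \<Rightarrow> ('a \<Rightarrow> net_class) \<Rightarrow> bool" where
  "regular_network \<epsilon> W M Z \<longleftrightarrow>
     (\<integral>\<^sup>+ \<omega>. ennreal (on_class (\<lambda>N i. \<Sum>j\<in>nbrs N i. weight N i j) (Z \<omega>)) \<partial>M) \<le> ennreal W \<and>
     (AE \<omega> in M.
        on_class (\<lambda>N i. Min ((\<lambda>x. \<bar>\<Sum>j\<in>nbrs N i. x j * weight N i j\<bar>)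
                              ` (nbrs N i \<rightarrow>\<^sub>E {-1, 1 :: real}))) (Z \<omega>) \<ge> \<epsilon>)"

text \<open>Almost surely, the classes \<open>Z t \<omega>\<close> are represented by networks with the same graph, weights and
  root for all \<open>t\<close>, whose labelings \<open>X t\<close> follow the majority rule without ties.\<close>

definition majority_dynamics :: "'a measure \<Rightarrow> (nat \<Rightarrow> 'a \<Rightarrow> net_class) \<Rightarrow> bool" where
  "majority_dynamics M Z \<longleftrightarrow>
     (AE \<omega> in M. \<exists>N i. \<exists>X :: nat \<Rightarrow> nat \<Rightarrow> real.
        i \<in> verts N \<and>
        (\<forall>t. connected_network (N\<lparr>label := X t\<rparr>) \<and> Z t \<omega> = iso_class (N\<lparr>label := X t\<rparr>) [i]) \<and>
        (\<forall>t>0. \<forall>v\<in>verts N.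
           (\<Sum>u\<in>nbrs N v. X (t - 1) u * weight N v u) \<noteq> 0 \<and>
           X t v = sgn (\<Sum>u\<in>nbrs N v. X (t - 1) u * weight N v u)))"

end

theory Submission
  imports Defs
begin

text \<open>The proof is an energy argument. Let
  \<open>E t\<close> be the expectation of \<open>\<Sum>j. w(I, j) (1 + X\<^sub>t\<^sub>+\<^sub>1(I) X\<^sub>t(j)) / 2\<close>, the expected weight of
  the edges at the root along which the next label of the root agrees with the present label of the
  neighbor. As the next labels are determined by the present ones through the majority rule, the
  summand is a function of the directed edge rooted network \<open>(N\<^sub>t, I, j)\<close>, so that unimodularity
  exchanges the two endpoints: \<open>E t\<close> is also the expectation of
  \<open>\<Sum>j. w(I, j) (1 + X\<^sub>t(I) X\<^sub>t\<^sub>+\<^sub>1(j)) / 2\<close>. Compared with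
  \<open>\<Sum>j. w(I, j) (1 + X\<^sub>t\<^sub>+\<^sub>2(I) X\<^sub>t\<^sub>+\<^sub>1(j)) / 2\<close>, whose expectation is \<open>E (t + 1)\<close>, the integrand is smaller
  by \<open>(X\<^sub>t\<^sub>+\<^sub>2(I) - X\<^sub>t(I)) s / 2\<close> with \<open>s = \<Sum>j. w(I, j) X\<^sub>t\<^sub>+\<^sub>1(j)\<close>. Since \<open>X\<^sub>t\<^sub>+\<^sub>2(I)\<close> is the sign of \<open>s\<close>, this
  difference is \<open>\<bar>s\<bar> \<ge> \<epsilon>\<close> if \<open>X\<^sub>t\<^sub>+\<^sub>2(I) \<noteq> X\<^sub>t(I)\<close>, and zero otherwise (\<open>orbit_agreement_gain\<close>).
  Hence \<open>E\<close> grows at each step by at least \<open>\<epsilon>\<close> times the probability of that event, while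
  \<open>0 \<le> E t \<le> W\<close> throughout (\<open>orbit_outgoing_agreement_le\<close>). The probabilities therefore add up to at
  most \<open>W / \<epsilon>\<close>, which bounds the expected number of changes; so this number is almost surely finite
  and the labels at the root are eventually periodic with period two.

  Unimodularity only applies to Borel functions of isomorphism classes. The summand is
  therefore assembled from three isomorphism invariants (the weight of the root edge, the weighted
  sum of the labels around the first root, the label of the last root), each of which is continuous
  for the local topology, as it depends continuously on the weights in a ball of radius one
  (\<open>class_value_measurable\<close>).\<close>

section \<open>Isomorphism invariants\<close>

text \<open>The map \<open>h\<close> is an isomorphism of unrooted networks. Naming it separates the map from the root data.\<close>

definition network_iso :: "(nat \<Rightarrow> nat) \<Rightarrow> network \<Rightarrow> network \<Rightarrow> bool" where
  "network_iso h N N' \<longleftrightarrow>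
     bij_betw h (verts N) (verts N') \<and>
     (\<forall>u\<in>verts N. \<forall>v\<in>verts N. (u, v) \<in> edges N \<longleftrightarrow> (h u, h v) \<in> edges N') \<and>
     (\<forall>v\<in>verts N. label N' (h v) = label N v) \<and>
     (\<forall>(u, v)\<in>edges N. weight N' (h u) (h v) = weight N u v)"

lemma isomorphic_iff:
  "isomorphic (N, rs) (N', rs') \<longleftrightarrow> (\<exists>h. network_iso h N N' \<and> map h rs = rs')"
  by (auto simp: isomorphic_def network_iso_def)

lemma network_iso_id: "network_iso id N N"
  by (auto simp: network_iso_def)

text \<open>The root data of a rooted network or of a directed edge rooted network. A loop at \<open>i\<close> gives rise to
  the two distinct lists \<open>[i]\<close> and \<open>[i, i]\<close>.\<close>

definition valid_roots :: "network \<Rightarrow> nat list \<Rightarrow> bool" where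
  "valid_roots N rs \<longleftrightarrow> (\<exists>i\<in>verts N. rs = [i]) \<or> (\<exists>(i, j)\<in>edges N. rs = [i, j])"

lemma valid_roots_edge: "(i, j) \<in> edges N \<Longrightarrow> valid_roots N [i, j]"
  by (auto simp: valid_roots_def)

lemma edges_verts:
  assumes "connected_network N" "(i, j) \<in> edges N"
  shows "i \<in> verts N" "j \<in> verts N"
  using assms by (auto simp: connected_network_def is_network_def)

lemma edges_commute:
  assumes "connected_network N" "(i, j) \<in> edges N"
  shows "(j, i) \<in> edges N" "weight N j i = weight N i j" "0 \<le> weight N i j"
  using assms by (auto simp: connected_network_def is_network_def dest: symD)

lemma finite_nbrs: "connected_network N \<Longrightarrow> i \<in> verts N \<Longrightarrow> finite (nbrs N i)"
  by (auto simp: connected_network_def is_network_def)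

lemma label_cases:
  "connected_network N \<Longrightarrow> i \<in> verts N \<Longrightarrow> label N i = -1 \<or> label N i = 1"
  by (auto simp: connected_network_def is_network_def)

lemma valid_roots_subset:
  "connected_network N \<Longrightarrow> valid_roots N rs \<Longrightarrow> rs \<noteq> [] \<and> set rs \<subseteq> verts N"
  using edges_verts by (auto simp: valid_roots_def)

lemma valid_roots_map:
  assumes "connected_network N" "network_iso h N N'" "valid_roots N rs"
  shows "valid_roots N' (map h rs)"
proof (cases "\<exists>i\<in>verts N. rs = [i]")
  case True
  then show ?thesis using assms(2) by (auto simp: valid_roots_def network_iso_def bij_betw_def)
next
  case False
  then obtain i j where "(i, j) \<in> edges N" "rs = [i, j]"
    using assms(3) by (auto simp: valid_roots_def)
  moreover have "i \<in> verts N" "j \<in> verts N"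
    using edges_verts[OF assms(1)] calculation by auto
  ultimately show ?thesis
    using assms(2) by (auto simp: valid_roots_def network_iso_def)
qed

lemma network_iso_nbrs:
  assumes "connected_network N" "connected_network N'" "network_iso h N N'" "i \<in> verts N"
  shows "bij_betw h (nbrs N i) (nbrs N' (h i))"
proof -
  have bij: "bij_betw h (verts N) (verts N')"
    and e: "\<And>u v. u \<in> verts N \<Longrightarrow> v \<in> verts N \<Longrightarrow> (u, v) \<in> edges N \<longleftrightarrow> (h u, h v) \<in> edges N'"
    using assms(3) by (auto simp: network_iso_def)
  have sub: "nbrs N i \<subseteq> verts N" using edges_verts[OF assms(1)] by (auto simp: nbrs_def)
  have "h ` nbrs N i = nbrs N' (h i)"
  proof
    show "h ` nbrs N i \<subseteq> nbrs N' (h i)"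
      using e assms(4) sub by (auto simp: nbrs_def)
    show "nbrs N' (h i) \<subseteq> h ` nbrs N i"
    proof
      fix v assume v: "v \<in> nbrs N' (h i)"
      then have "v \<in> verts N'" using edges_verts[OF assms(2)] by (auto simp: nbrs_def)
      then obtain u where "u \<in> verts N" "v = h u" using bij by (auto simp: bij_betw_def)
      then show "v \<in> h ` nbrs N i" using v e assms(4) by (auto simp: nbrs_def)
    qed
  qed
  then show ?thesis using bij sub by (auto simp: bij_betw_def intro: inj_on_subset)
qed

text \<open>Functions of connected networks with root data that are invariant under isomorphism. Nothing is
  required for other root data, where for instance weights of non-edges are meaningless.\<close>

definition iso_invariant :: "(network \<times> nat list \<Rightarrow> 'b) \<Rightarrow> bool" where
  "iso_invariant \<phi> \<longleftrightarrow> (\<forall>N N' h rs. connected_network N \<and> connected_network N' \<and>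
     network_iso h N N' \<and> valid_roots N rs \<longrightarrow> \<phi> (N', map h rs) = \<phi> (N, rs))"

lemma iso_invariantI:
  assumes "\<And>N N' h rs. connected_network N \<Longrightarrow> connected_network N' \<Longrightarrow> network_iso h N N' \<Longrightarrow>
    valid_roots N rs \<Longrightarrow> \<phi> (N', map h rs) = \<phi> (N, rs)"
  shows "iso_invariant \<phi>"
  using assms unfolding iso_invariant_def by blast

lemma iso_invariantD:
  assumes "iso_invariant \<phi>" "connected_network N" "connected_network N'" "network_iso h N N'"
    "valid_roots N rs"
  shows "\<phi> (N', map h rs) = \<phi> (N, rs)"
  using assms unfolding iso_invariant_def by blast

lemma iso_invariant_compose2:
  assumes "iso_invariant \<phi>" "iso_invariant \<psi>"
  shows "iso_invariant (\<lambda>x. g (\<phi> x) (\<psi> x))"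
proof (rule iso_invariantI)
  fix N N' h rs
  assume *: "connected_network N" "connected_network N'" "network_iso h N N'" "valid_roots N rs"
  show "g (\<phi> (N', map h rs)) (\<psi> (N', map h rs)) = g (\<phi> (N, rs)) (\<psi> (N, rs))"
    using iso_invariantD[OF assms(1) *] iso_invariantD[OF assms(2) *] by simp
qed

text \<open>The value of \<open>\<phi>\<close> on an isomorphism class. In contrast to \<open>on_class\<close>, the whole list of roots is
  passed to \<open>\<phi>\<close>, so that edge rooted classes are covered as well.\<close>

definition class_value :: "(network \<times> nat list \<Rightarrow> 'b) \<Rightarrow> net_class \<Rightarrow> 'b" where
  "class_value \<phi> c = \<phi> (SOME x. x \<in> c)"

lemma on_class_eq: "on_class \<phi> = class_value (\<lambda>(N, rs). \<phi> N (hd rs))"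
  by (simp add: fun_eq_iff on_class_def class_value_def)

lemma iso_class_self: "connected_network N \<Longrightarrow> (N, rs) \<in> iso_class N rs"
  using network_iso_id[of N] by (auto simp: iso_class_def isomorphic_iff intro!: exI[of _ id])

lemma iso_classE:
  assumes "x \<in> iso_class N rs"
  obtains N' h where "x = (N', map h rs)" "connected_network N'" "network_iso h N N'"
  using assms by (auto simp: iso_class_def isomorphic_iff)

lemma some_in_iso_class:
  "connected_network N \<Longrightarrow> (SOME x. x \<in> iso_class N rs) \<in> iso_class N rs"
  by (rule someI_ex) (blast intro: iso_class_self)

lemma iso_invariant_member:
  assumes "iso_invariant \<phi>" "connected_network N" "valid_roots N rs" "x \<in> iso_class N rs"
  shows "\<phi> x = \<phi> (N, rs)"
  using assms(4) by (rule iso_classE) (simp add: iso_invariantD[OF assms(1,2) _ _ assms(3)])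

lemma class_value_iso_class:
  assumes "iso_invariant \<phi>" "connected_network N" "valid_roots N rs"
  shows "class_value \<phi> (iso_class N rs) = \<phi> (N, rs)"
  unfolding class_value_def
  by (rule iso_invariant_member[OF assms some_in_iso_class[OF assms(2)]])

lemma iso_invariant_nbr_sum:
  fixes \<psi> :: "network \<times> nat list \<Rightarrow> 'b :: comm_monoid_add"
  assumes "iso_invariant \<psi>"
  shows "iso_invariant (\<lambda>(N, rs). \<Sum>j\<in>nbrs N (hd rs). \<psi> (N, [hd rs, j]))"
proof (rule iso_invariantI)
  fix N N' h rs
  assume N: "connected_network N" "connected_network N'" and h: "network_iso h N N'"
    and rs: "valid_roots N rs"
  have ne: "rs \<noteq> []" and v: "hd rs \<in> verts N"
    using valid_roots_subset[OF N(1) rs] hd_in_set[of rs] by auto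
  have "(\<Sum>j\<in>nbrs N' (h (hd rs)). \<psi> (N', [h (hd rs), j]))
      = (\<Sum>j\<in>nbrs N (hd rs). \<psi> (N', [h (hd rs), h j]))"
    by (rule sum.reindex_bij_betw[symmetric, OF network_iso_nbrs[OF N h v]])
  also have "\<dots> = (\<Sum>j\<in>nbrs N (hd rs). \<psi> (N, [hd rs, j]))"
  proof (rule sum.cong[OF refl])
    fix j assume "j \<in> nbrs N (hd rs)"
    then have "valid_roots N [hd rs, j]" by (auto simp: valid_roots_def nbrs_def)
    from iso_invariantD[OF assms N h this] show "\<psi> (N', [h (hd rs), h j]) = \<psi> (N, [hd rs, j])" by simp
  qed
  finally show "(case (N', map h rs) of (N, rs) \<Rightarrow> \<Sum>j\<in>nbrs N (hd rs). \<psi> (N, [hd rs, j]))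
      = (case (N, rs) of (N, rs) \<Rightarrow> \<Sum>j\<in>nbrs N (hd rs). \<psi> (N, [hd rs, j]))"
    using ne by (simp add: hd_map)
qed

lemma on_class_nbr_sum:
  fixes \<psi> :: "network \<times> nat list \<Rightarrow> 'b :: comm_monoid_add"
  assumes "iso_invariant \<psi>" "connected_network N" "i \<in> verts N"
  shows "on_class (\<lambda>N i. \<Sum>j\<in>nbrs N i. \<psi> (N, [i, j])) (iso_class N [i])
       = (\<Sum>j\<in>nbrs N i. \<psi> (N, [i, j]))"
  unfolding on_class_eq
  by (subst class_value_iso_class[OF iso_invariant_nbr_sum[OF assms(1)] assms(2)])
     (use assms(3) in \<open>auto simp: valid_roots_def\<close>)

lemma iso_invariant_label_hd: "iso_invariant (\<lambda>(N, rs). label N (hd rs))"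
  by (rule iso_invariantI) (auto simp: network_iso_def hd_map subsetD[OF _ hd_in_set] dest: valid_roots_subset)

lemma iso_invariant_label_last: "iso_invariant (\<lambda>(N, rs). label N (last rs))"
  by (rule iso_invariantI) (auto simp: network_iso_def last_map subsetD[OF _ last_in_set] dest: valid_roots_subset)

text \<open>The weight of the root edge. It is set to zero if the first and the last root are not joined by an
  edge; this makes it an isomorphism invariant, also on rooted networks \<open>(N, [i])\<close> without a loop
  at \<open>i\<close>.\<close>

definition root_weight :: "network \<times> nat list \<Rightarrow> real" where
  "root_weight = (\<lambda>(N, rs). if (hd rs, last rs) \<in> edges N then weight N (hd rs) (last rs) else 0)"

lemma iso_invariant_root_weight: "iso_invariant root_weight"
proof (rule iso_invariantI)
  fix N N' h rs
  assume N: "connected_network N" "connected_network N'" and h: "network_iso h N N'"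
    and rs: "valid_roots N rs"
  have ne: "rs \<noteq> []" and v: "hd rs \<in> verts N" "last rs \<in> verts N"
    using valid_roots_subset[OF N(1) rs] hd_in_set[of rs] last_in_set[of rs] by auto
  have "(hd rs, last rs) \<in> edges N \<longleftrightarrow> (h (hd rs), h (last rs)) \<in> edges N'"
    using h v by (auto simp: network_iso_def)
  moreover have "(hd rs, last rs) \<in> edges N \<Longrightarrow>
      weight N' (h (hd rs)) (h (last rs)) = weight N (hd rs) (last rs)"
    using h by (auto simp: network_iso_def)
  ultimately show "root_weight (N', map h rs) = root_weight (N, rs)"
    using ne by (auto simp: root_weight_def hd_map last_map)
qed

text \<open>The weighted sum of the labels of the neighbors of the first root. Its sign is the next label of
  that root under majority dynamics.\<close>

definition root_field :: "network \<times> nat list \<Rightarrow> real" where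
  "root_field = (\<lambda>(N, rs). \<Sum>u\<in>nbrs N (hd rs). label N u * weight N (hd rs) u)"

lemma iso_invariant_root_field: "iso_invariant root_field"
proof -
  let ?\<psi> = "\<lambda>x. root_weight x * (case x of (N, rs) \<Rightarrow> label N (last rs))"
  have "iso_invariant ?\<psi>"
    by (rule iso_invariant_compose2[OF iso_invariant_root_weight iso_invariant_label_last])
  moreover have "root_field = (\<lambda>(N, rs). \<Sum>j\<in>nbrs N (hd rs). ?\<psi> (N, [hd rs, j]))"
    by (auto simp: fun_eq_iff root_field_def root_weight_def nbrs_def intro!: sum.cong)
  ultimately show ?thesis using iso_invariant_nbr_sum[of ?\<psi>] by simp
qed

lemma iso_invariant_degree: "iso_invariant (\<lambda>(N, rs). card (nbrs N (hd rs)))"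
  using iso_invariant_nbr_sum[of "\<lambda>_. 1 :: nat", OF iso_invariantI] by simp

section \<open>Measurability for the local topology\<close>

text \<open>Continuity in the labeled graph and the weights of the ball of radius one. The modulus \<open>\<delta>\<close> may depend
  on the degree \<open>d\<close> of the first root, as a sum over neighbors requires.\<close>

definition locally_continuous :: "(network \<times> nat list \<Rightarrow> real) \<Rightarrow> bool" where
  "locally_continuous \<phi> \<longleftrightarrow> (\<forall>d. \<forall>e>0. \<exists>\<delta>>0. \<forall>N rs N' rs'.
     connected_network N \<and> valid_roots N rs \<and> connected_network N' \<and> valid_roots N' rs' \<and>
     card (nbrs N (hd rs)) = d \<and> ball_close 1 \<delta> (N, rs) (N', rs') \<longrightarrow>
     \<bar>\<phi> (N', rs') - \<phi> (N, rs)\<bar> < e)"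

lemma ball_close_refl: "0 < \<delta> \<Longrightarrow> ball_close r \<delta> x x"
  by (cases x) (auto simp: ball_close_def intro!: exI[of _ id])

lemma topspace_local_topology: "topspace (local_topology K) \<subseteq> K"
  by (auto simp: local_topology_def local_nbhd_def)

lemma opens_subset_Pow: "{U. openin (local_topology K) U} \<subseteq> Pow K"
  using topspace_local_topology[of K] by (auto dest!: openin_subset)

lemma local_borel_space [simp]: "space (local_borel K) = K"
  unfolding local_borel_def by (rule space_measure_of[OF opens_subset_Pow])

lemma openin_in_local_borel:
  "openin (local_topology K) U \<Longrightarrow> U \<in> sets (local_borel K)"
  unfolding local_borel_def sets_measure_of[OF opens_subset_Pow] by (rule sigma_sets.Basic) simp

text \<open>Locally continuous invariants are continuous, hence Borel, for the local topology. The neighborhoods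
  \<open>local_nbhd\<close> refer to some representative of the central class, so one \<open>\<delta>\<close> has to serve all
  representatives: it does, since the degree of the root is itself an invariant.\<close>

lemma class_value_measurable:
  assumes K: "\<And>c. c \<in> K \<Longrightarrow> \<exists>N rs. connected_network N \<and> valid_roots N rs \<and> c = iso_class N rs"
    and inv: "iso_invariant \<phi>" and cont: "locally_continuous \<phi>"
  shows "class_value \<phi> \<in> borel_measurable (local_borel K)"
proof (rule borel_measurableI)
  fix S :: "real set" assume S: "open S"
  let ?P = "class_value \<phi> -` S \<inter> K"
  have nb: "\<exists>\<delta>>0. local_nbhd K c 1 \<delta> \<subseteq> ?P" if c: "c \<in> ?P" for c
  proof -
    obtain N rs where N: "connected_network N" "valid_roots N rs" "c = iso_class N rs"
      using K[OF IntD2[OF c]] by (elim exE conjE) (rule that)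
    obtain e where e: "e > 0" "\<And>y. dist y (class_value \<phi> c) < e \<Longrightarrow> y \<in> S"
      using S c unfolding open_dist by blast
    obtain \<delta> where "\<delta> > 0" and d: "\<And>N1 rs1 N2 rs2.
        connected_network N1 \<Longrightarrow> valid_roots N1 rs1 \<Longrightarrow> connected_network N2 \<Longrightarrow>
        valid_roots N2 rs2 \<Longrightarrow> card (nbrs N1 (hd rs1)) = card (nbrs N (hd rs)) \<Longrightarrow>
        ball_close 1 \<delta> (N1, rs1) (N2, rs2) \<Longrightarrow> \<bar>\<phi> (N2, rs2) - \<phi> (N1, rs1)\<bar> < e"
      using cont[unfolded locally_continuous_def, rule_format, OF e(1), of "card (nbrs N (hd rs))"]
      by blast
    have "local_nbhd K c 1 \<delta> \<subseteq> ?P"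
    proof
      fix c' assume "c' \<in> local_nbhd K c 1 \<delta>"
      then obtain x x' where c': "c' \<in> K" and x: "x \<in> c" and x': "x' \<in> c'"
        and close: "ball_close 1 \<delta> x x'" by (auto simp: local_nbhd_def)
      obtain N' rs' where N': "connected_network N'" "valid_roots N' rs'" "c' = iso_class N' rs'"
        using K[OF c'] by (elim exE conjE) (rule that)
      obtain N1 h1 where 1: "x = (N1, map h1 rs)" "connected_network N1" "network_iso h1 N N1"
        by (rule iso_classE[OF x[unfolded N(3)]])
      obtain N2 h2 where 2: "x' = (N2, map h2 rs')" "connected_network N2" "network_iso h2 N' N2"
        by (rule iso_classE[OF x'[unfolded N'(3)]])
      have rs1: "valid_roots N1 (map h1 rs)" by (rule valid_roots_map[OF N(1) 1(3) N(2)])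
      have rs2: "valid_roots N2 (map h2 rs')" by (rule valid_roots_map[OF N'(1) 2(3) N'(2)])
      have "card (nbrs N1 (hd (map h1 rs))) = card (nbrs N (hd rs))"
        using iso_invariantD[OF iso_invariant_degree N(1) 1(2,3) N(2)] by simp
      from d[OF 1(2) rs1 2(2) rs2 this close[unfolded 1(1) 2(1)]]
      have "\<bar>\<phi> x' - \<phi> x\<bar> < e" unfolding 1(1) 2(1) .
      moreover have "class_value \<phi> c = \<phi> x"
        unfolding N(3) class_value_iso_class[OF inv N(1,2)] 1(1)
        by (rule iso_invariantD[OF inv N(1) 1(2,3) N(2), symmetric])
      moreover have "class_value \<phi> c' = \<phi> x'"
        unfolding N'(3) class_value_iso_class[OF inv N'(1,2)] 2(1)
        by (rule iso_invariantD[OF inv N'(1) 2(2,3) N'(2), symmetric])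
      ultimately have "dist (class_value \<phi> c') (class_value \<phi> c) < e"
        by (simp add: dist_real_def)
      then show "c' \<in> ?P" using e(2) c' by blast
    qed
    with \<open>\<delta> > 0\<close> show ?thesis by blast
  qed
  have self: "c \<in> local_nbhd K c 1 \<delta>" if c: "c \<in> K" and \<delta>: "0 < \<delta>" for c \<delta>
  proof -
    obtain N rs where "connected_network N" "c = iso_class N rs" using K[OF c]
      by (elim exE conjE) (rule that)
    then have "(N, rs) \<in> c" using iso_class_self by simp
    with c \<delta> ball_close_refl[OF \<delta>] show ?thesis unfolding local_nbhd_def by blast
  qed
  have "openin (local_topology K) ?P"
    unfolding openin_subopen[of _ ?P]
  proof
    fix c assume c: "c \<in> ?P"
    with nb obtain \<delta> where \<delta>: "\<delta> > 0" "local_nbhd K c 1 \<delta> \<subseteq> ?P" by blast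
    have "openin (local_topology K) (local_nbhd K c 1 \<delta>)"
      unfolding local_topology_def using c \<delta>(1) by (intro topology_generated_by_Basis) blast
    with \<delta>(2) self[OF IntD2[OF c] \<delta>(1)]
    show "\<exists>T. openin (local_topology K) T \<and> c \<in> T \<and> T \<subseteq> ?P" by blast
  qed
  from openin_in_local_borel[OF this]
  show "class_value \<phi> -` S \<inter> space (local_borel K) \<in> sets (local_borel K)" by simp
qed

text \<open>An almost isomorphism of balls of radius one restricts to bijections between the neighborhoods of
  the roots.\<close>

lemma ball_close_1E:
  assumes "ball_close 1 \<delta> (N, rs) (N', rs')"
  obtains h where "map h rs = rs'"
    "\<And>v. v \<in> set rs \<Longrightarrow> label N' (h v) = label N v"
    "\<And>u v. u \<in> set rs \<Longrightarrow> v \<in> set rs \<Longrightarrow> (u, v) \<in> edges N \<longleftrightarrow> (h u, h v) \<in> edges N'"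
    "\<And>u v. u \<in> set rs \<Longrightarrow> v \<in> nbrs N u \<Longrightarrow> \<bar>weight N' (h u) (h v) - weight N u v\<bar> < \<delta>"
    "\<And>u v. u \<in> set rs \<Longrightarrow> v \<in> nbrs N u \<Longrightarrow> label N' (h v) = label N v"
    "\<And>u. u \<in> set rs \<Longrightarrow> bij_betw h (nbrs N u) (nbrs N' (h u))"
proof -
  let ?B = "graph_ball N (set rs) 1" and ?B' = "graph_ball N' (set rs') 1"
  from assms obtain h where h: "bij_betw h ?B ?B'" "map h rs = rs'"
    and e: "\<And>u v. u \<in> ?B \<Longrightarrow> v \<in> ?B \<Longrightarrow> (u, v) \<in> edges N \<longleftrightarrow> (h u, h v) \<in> edges N'"
    and w: "\<And>u v. u \<in> ?B \<Longrightarrow> v \<in> ?B \<Longrightarrow> (u, v) \<in> edges N \<Longrightarrow>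
      \<bar>weight N' (h u) (h v) - weight N u v\<bar> < \<delta>"
    and l: "\<And>v. v \<in> ?B \<Longrightarrow> label N' (h v) = label N v"
    unfolding ball_close_def by (auto simp del: graph_ball.simps)
  have rB: "u \<in> ?B" if "u \<in> set rs" for u using that by simp
  have nB: "v \<in> ?B" if "u \<in> set rs" "v \<in> nbrs N u" for u v using that by auto
  have bij: "bij_betw h (nbrs N u) (nbrs N' (h u))" if u: "u \<in> set rs" for u
  proof -
    have "h ` nbrs N u = nbrs N' (h u)"
    proof
      show "h ` nbrs N u \<subseteq> nbrs N' (h u)"
        using e[OF rB[OF u] nB[OF u]] by (auto simp: nbrs_def)
      show "nbrs N' (h u) \<subseteq> h ` nbrs N u"
      proof
        fix v assume v: "v \<in> nbrs N' (h u)"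
        have "h u \<in> set rs'" using h(2) u by auto
        with v have "v \<in> ?B'" by auto
        then obtain v0 where "v0 \<in> ?B" "v = h v0" using h(1) unfolding bij_betw_def by blast
        with v e[OF rB[OF u], of v0] show "v \<in> h ` nbrs N u" unfolding nbrs_def by blast
      qed
    qed
    moreover have "inj_on h (nbrs N u)"
      using h(1) nB[OF u] unfolding bij_betw_def by (meson inj_on_subset subsetI)
    ultimately show ?thesis by (simp add: bij_betw_def)
  qed
  show ?thesis
    by (rule that[OF h(2) l[OF rB] e[OF rB rB] w[OF rB nB] l[OF nB] bij]) (auto simp: nbrs_def)
qed

lemma locally_continuous_label:
  assumes sel: "\<And>rs. rs \<noteq> [] \<Longrightarrow> sel rs \<in> set rs"
    and sel_map: "\<And>h rs. rs \<noteq> [] \<Longrightarrow> sel (map h rs) = h (sel rs)"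
  shows "locally_continuous (\<lambda>(N, rs). label N (sel rs))"
  unfolding locally_continuous_def
proof (intro allI impI exI[of _ 1] conjI, simp, elim conjE)
  fix d and e :: real and N rs N' rs'
  assume "0 < e" and N: "connected_network N" "valid_roots N rs"
    and b: "ball_close 1 1 (N, rs) (N', rs')"
  have ne: "rs \<noteq> []" using valid_roots_subset[OF N] by simp
  obtain h where "map h rs = rs'" "\<And>v. v \<in> set rs \<Longrightarrow> label N' (h v) = label N v"
    using b by (rule ball_close_1E) blast
  then have "label N' (sel rs') = label N (sel rs)"
    using sel[OF ne] sel_map[OF ne, of h] by auto
  with \<open>0 < e\<close> show "\<bar>(case (N', rs') of (N, rs) \<Rightarrow> label N (sel rs)) -
          (case (N, rs) of (N, rs) \<Rightarrow> label N (sel rs))\<bar> < e"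
    by simp
qed

lemma locally_continuous_root_weight: "locally_continuous root_weight"
  unfolding locally_continuous_def
proof (intro allI impI)
  fix d :: nat and e :: real assume e: "0 < e"
  have "\<bar>root_weight (N', rs') - root_weight (N, rs)\<bar> < e"
    if N: "connected_network N" "valid_roots N rs" and b: "ball_close 1 e (N, rs) (N', rs')"
    for N rs N' rs'
  proof -
    have ne: "rs \<noteq> []" using valid_roots_subset[OF N] by simp
    from b obtain h where h: "map h rs = rs'"
      "\<And>u v. u \<in> set rs \<Longrightarrow> v \<in> set rs \<Longrightarrow> (u, v) \<in> edges N \<longleftrightarrow> (h u, h v) \<in> edges N'"
      "\<And>u v. u \<in> set rs \<Longrightarrow> v \<in> nbrs N u \<Longrightarrow> \<bar>weight N' (h u) (h v) - weight N u v\<bar> < e"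
      by (rule ball_close_1E) blast
    from h(2)[of "hd rs" "last rs"] h(3)[of "hd rs" "last rs"] h(1) ne e show ?thesis
      by (auto simp: root_weight_def nbrs_def hd_map last_map)
  qed
  with e show "\<exists>\<delta>>0. \<forall>N rs N' rs'.
     connected_network N \<and> valid_roots N rs \<and> connected_network N' \<and> valid_roots N' rs' \<and>
     card (nbrs N (hd rs)) = d \<and> ball_close 1 \<delta> (N, rs) (N', rs') \<longrightarrow>
     \<bar>root_weight (N', rs') - root_weight (N, rs)\<bar> < e" by blast
qed

lemma locally_continuous_root_field: "locally_continuous root_field"
  unfolding locally_continuous_def
proof (intro allI impI)
  fix d :: nat and e :: real assume e: "0 < e"
  \<comment> \<open>The denominator is kept positive also for a root without neighbors.\<close>
  define \<delta> where "\<delta> = e / (real d + 1)"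
  have \<delta>: "0 < \<delta>" "real d * \<delta> < e" using e by (auto simp: \<delta>_def field_simps)
  have "\<bar>root_field (N', rs') - root_field (N, rs)\<bar> < e"
    if N: "connected_network N" "valid_roots N rs" and d: "card (nbrs N (hd rs)) = d"
      and b: "ball_close 1 \<delta> (N, rs) (N', rs')" for N rs N' rs'
  proof -
    define i where "i = hd rs"
    have ne: "rs \<noteq> []" and i: "i \<in> set rs"
      using valid_roots_subset[OF N] by (auto simp: i_def)
    from b obtain h where h: "map h rs = rs'"
      "\<And>u v. u \<in> set rs \<Longrightarrow> v \<in> nbrs N u \<Longrightarrow> \<bar>weight N' (h u) (h v) - weight N u v\<bar> < \<delta>"
      "\<And>u v. u \<in> set rs \<Longrightarrow> v \<in> nbrs N u \<Longrightarrow> label N' (h v) = label N v"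
      "\<And>u. u \<in> set rs \<Longrightarrow> bij_betw h (nbrs N u) (nbrs N' (h u))"
      by (rule ball_close_1E) blast
    have "root_field (N', rs') = (\<Sum>u\<in>nbrs N' (h i). label N' u * weight N' (h i) u)"
      using ne h(1) by (auto simp: root_field_def i_def hd_map)
    also have "\<dots> = (\<Sum>u\<in>nbrs N i. label N' (h u) * weight N' (h i) (h u))"
      by (rule sum.reindex_bij_betw[OF h(4)[OF i], symmetric])
    also have "\<dots> = (\<Sum>u\<in>nbrs N i. label N u * weight N' (h i) (h u))"
      using h(3)[OF i] by (auto intro!: sum.cong)
    finally have "root_field (N', rs') - root_field (N, rs)
        = (\<Sum>u\<in>nbrs N i. label N u * (weight N' (h i) (h u) - weight N i u))"
      by (simp add: root_field_def i_def sum_subtractf right_diff_distrib)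
    also have "\<bar>\<dots>\<bar> \<le> (\<Sum>u\<in>nbrs N i. \<bar>label N u * (weight N' (h i) (h u) - weight N i u)\<bar>)"
      by (rule sum_abs)
    also have "\<dots> \<le> (\<Sum>u\<in>nbrs N i. \<delta>)"
    proof (rule sum_mono)
      fix u assume u: "u \<in> nbrs N i"
      then have "u \<in> verts N" using edges_verts[OF N(1)] by (auto simp: nbrs_def)
      then have "\<bar>label N u\<bar> = 1" using label_cases[OF N(1)] by fastforce
      then show "\<bar>label N u * (weight N' (h i) (h u) - weight N i u)\<bar> \<le> \<delta>"
        using h(2)[OF i u] by (simp add: abs_mult)
    qed
    also have "\<dots> < e" using d \<delta>(2) by (simp add: i_def)
    finally show ?thesis .
  qed
  with \<delta>(1) show "\<exists>\<delta>>0. \<forall>N rs N' rs'.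
     connected_network N \<and> valid_roots N rs \<and> connected_network N' \<and> valid_roots N' rs' \<and>
     card (nbrs N (hd rs)) = d \<and> ball_close 1 \<delta> (N, rs) (N', rs') \<longrightarrow>
     \<bar>root_field (N', rs') - root_field (N, rs)\<bar> < e" by blast
qed

lemma root_label_measurable: "root_label \<in> borel_measurable (local_borel rooted_classes)"
proof -
  have "\<exists>N rs. connected_network N \<and> valid_roots N rs \<and> c = iso_class N rs"
    if "c \<in> rooted_classes" for c
  proof -
    obtain N i where "connected_network N" "i \<in> verts N" "c = iso_class N [i]"
      using \<open>c \<in> rooted_classes\<close> by (auto simp: rooted_classes_def)
    moreover have "valid_roots N [i]" using \<open>i \<in> verts N\<close> by (simp add: valid_roots_def)
    ultimately show ?thesis by blast
  qed
  moreover have "locally_continuous (\<lambda>(N, rs). label N (hd rs))"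
    by (rule locally_continuous_label) (simp_all add: hd_map)
  ultimately show ?thesis
    unfolding root_label_def on_class_eq
    by (intro class_value_measurable[OF _ iso_invariant_label_hd])
qed

section \<open>The energy of an edge\<close>

text \<open>For an edge \<open>(i, j)\<close>, this is its weight if the next label of \<open>i\<close> equals the present label of \<open>j\<close>,
  and zero if the two differ (half the weight in case of a tie at \<open>i\<close>). Its sum over the neighbors
  of the root is the integrand of the energy.\<close>

definition edge_agreement :: "network \<times> nat list \<Rightarrow> real" where
  "edge_agreement x =
     root_weight x * (1 + sgn (root_field x) * (case x of (N, rs) \<Rightarrow> label N (last rs))) / 2"

lemma iso_invariant_edge_agreement: "iso_invariant edge_agreement"
proof -
  have "iso_invariant (\<lambda>x. root_weight x *
      (\<lambda>x. 1 + sgn (root_field x) * (case x of (N, rs) \<Rightarrow> label N (last rs))) x / 2)"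
    by (intro iso_invariant_compose2[of _ _ "\<lambda>a b. a * b / 2"]
        iso_invariant_compose2[of _ _ "\<lambda>a b. 1 + sgn a * b"]
        iso_invariant_root_weight iso_invariant_root_field iso_invariant_label_last)
  then show ?thesis by (simp add: edge_agreement_def[abs_def])
qed

lemma edge_agreement_measurable:
  "class_value edge_agreement \<in> borel_measurable (local_borel edge_rooted_classes)"
proof -
  have K: "\<exists>N rs. connected_network N \<and> valid_roots N rs \<and> c = iso_class N rs"
    if "c \<in> edge_rooted_classes" for c
  proof -
    obtain N i j where "connected_network N" "(i, j) \<in> edges N" "c = iso_class N [i, j]"
      using \<open>c \<in> edge_rooted_classes\<close> by (auto simp: edge_rooted_classes_def)
    moreover have "valid_roots N [i, j]" using \<open>(i, j) \<in> edges N\<close> by (auto simp: valid_roots_def)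
    ultimately show ?thesis by blast
  qed
  have lab: "locally_continuous (\<lambda>(N, rs). label N (last rs))"
    by (rule locally_continuous_label) (simp_all add: last_map)
  note class_value_measurable[OF K iso_invariant_root_weight locally_continuous_root_weight, measurable]
    class_value_measurable[OF K iso_invariant_root_field locally_continuous_root_field, measurable]
    class_value_measurable[OF K iso_invariant_label_last lab, measurable]
  have "class_value edge_agreement = (\<lambda>c. class_value root_weight c *
      (1 + sgn (class_value root_field c) * class_value (\<lambda>(N, rs). label N (last rs)) c) / 2)"
    by (simp add: fun_eq_iff class_value_def edge_agreement_def)
  then show ?thesis by simp
qed

lemma edge_agreement_edge:
  assumes "(i, j) \<in> edges N"
  shows "edge_agreement (N, [i, j]) =
    weight N i j * (1 + sgn (\<Sum>u\<in>nbrs N i. label N u * weight N i u) * label N j) / 2"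
  using assms by (simp add: edge_agreement_def root_weight_def root_field_def)

text \<open>The two sides of the mass transport principle for \<open>edge_agreement\<close>: in \<open>outgoing_agreement\<close> the
  next label is taken at the root, in \<open>incoming_agreement\<close> at its neighbors.\<close>

definition outgoing_agreement :: "net_class \<Rightarrow> ennreal" where
  "outgoing_agreement =
     on_class (\<lambda>N i. \<Sum>j\<in>nbrs N i. ennreal (class_value edge_agreement (iso_class N [i, j])))"

definition incoming_agreement :: "net_class \<Rightarrow> ennreal" where
  "incoming_agreement =
     on_class (\<lambda>N i. \<Sum>j\<in>nbrs N i. ennreal (class_value edge_agreement (iso_class N [j, i])))"

lemma nn_integral_agreement:
  assumes "unimodular M Z"
  shows "(\<integral>\<^sup>+ \<omega>. outgoing_agreement (Z \<omega>) \<partial>M) = (\<integral>\<^sup>+ \<omega>. incoming_agreement (Z \<omega>) \<partial>M)"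
proof -
  have "(\<lambda>c. ennreal (class_value edge_agreement c)) \<in> borel_measurable (local_borel edge_rooted_classes)"
    using edge_agreement_measurable by measurable
  with assms show ?thesis
    unfolding unimodular_def outgoing_agreement_def incoming_agreement_def by blast
qed

lemma valid_roots_rev:
  assumes "connected_network N" "valid_roots N rs"
  shows "valid_roots N (rev rs)"
proof (cases "\<exists>i\<in>verts N. rs = [i]")
  case True
  then show ?thesis by (auto simp: valid_roots_def)
next
  case False
  then obtain i j where ij: "(i, j) \<in> edges N" "rs = [i, j]"
    using assms(2) by (auto simp: valid_roots_def)
  show ?thesis using valid_roots_edge[OF edges_commute(1)[OF assms(1) ij(1)]] ij(2) by simp
qed

text \<open>Used with \<open>g\<close> the identity and with \<open>g = rev\<close>, which exchanges the endpoints of a root edge.\<close>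

lemma iso_invariant_class_value:
  assumes "iso_invariant \<phi>"
    and "\<And>N rs. connected_network N \<Longrightarrow> valid_roots N rs \<Longrightarrow> valid_roots N (g rs)"
    and "\<And>h rs. g (map h rs) = map h (g rs)"
  shows "iso_invariant (\<lambda>(N, rs). class_value \<phi> (iso_class N (g rs)))"
proof (rule iso_invariantI)
  fix N N' h rs
  assume *: "connected_network N" "connected_network N'" "network_iso h N N'" "valid_roots N rs"
  have g: "valid_roots N (g rs)" by (rule assms(2)[OF *(1,4)])
  have "class_value \<phi> (iso_class N' (map h (g rs))) = class_value \<phi> (iso_class N (g rs))"
    using class_value_iso_class[OF assms(1) *(1) g] iso_invariantD[OF assms(1) *(1-3) g]
      class_value_iso_class[OF assms(1) *(2) valid_roots_map[OF *(1,3) g]] by simp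
  then show "(case (N', map h rs) of (N, rs) \<Rightarrow> class_value \<phi> (iso_class N (g rs))) =
      (case (N, rs) of (N, rs) \<Rightarrow> class_value \<phi> (iso_class N (g rs)))"
    by (simp add: assms(3))
qed

lemma outgoing_agreement_eq:
  assumes N: "connected_network N" "i \<in> verts N"
  shows "outgoing_agreement (iso_class N [i]) =
    (\<Sum>j\<in>nbrs N i. ennreal (edge_agreement (N, [i, j])))"
proof -
  let ?\<phi> = "\<lambda>(N, rs). class_value edge_agreement (iso_class N rs)"
  have "iso_invariant ?\<phi>"
    by (rule iso_invariant_class_value[OF iso_invariant_edge_agreement, of "(\<lambda>rs. rs)"])
       (simp_all add: valid_roots_rev rev_map)
  then have "iso_invariant (\<lambda>x. ennreal (?\<phi> x))"
    using iso_invariant_compose2[of ?\<phi> ?\<phi> "\<lambda>a _. ennreal a"] by simp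
  from on_class_nbr_sum[OF this N] show ?thesis
    unfolding outgoing_agreement_def using N(1)
    by (simp add: class_value_iso_class[OF iso_invariant_edge_agreement] nbrs_def valid_roots_edge)
qed

lemma incoming_agreement_eq:
  assumes N: "connected_network N" "i \<in> verts N"
  shows "incoming_agreement (iso_class N [i]) =
    (\<Sum>j\<in>nbrs N i. ennreal (edge_agreement (N, [j, i])))"
proof -
  let ?\<phi> = "\<lambda>(N, rs). class_value edge_agreement (iso_class N (rev rs))"
  have "iso_invariant ?\<phi>"
    by (rule iso_invariant_class_value[OF iso_invariant_edge_agreement, of "rev"])
       (simp_all add: valid_roots_rev rev_map)
  then have "iso_invariant (\<lambda>x. ennreal (?\<phi> x))"
    using iso_invariant_compose2[of ?\<phi> ?\<phi> "\<lambda>a _. ennreal a"] by simp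
  note sum = on_class_nbr_sum[OF this N]
  have "valid_roots N [j, i]" if "j \<in> nbrs N i" for j
    using valid_roots_edge[OF edges_commute(1)[OF N(1)]] that by (simp add: nbrs_def)
  then show ?thesis
    unfolding incoming_agreement_def using sum N(1)
    by (simp add: class_value_iso_class[OF iso_invariant_edge_agreement])
qed

lemma total_weight_eq:
  assumes N: "connected_network N" "i \<in> verts N"
  shows "on_class (\<lambda>N i. \<Sum>j\<in>nbrs N i. weight N i j) (iso_class N [i])
    = (\<Sum>j\<in>nbrs N i. weight N i j)"
proof -
  have "(\<lambda>N i. \<Sum>j\<in>nbrs N i. weight N i j) = (\<lambda>N i. \<Sum>j\<in>nbrs N i. root_weight (N, [i, j]))"
    by (auto simp: fun_eq_iff root_weight_def nbrs_def intro!: sum.cong)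
  then show ?thesis using on_class_nbr_sum[OF iso_invariant_root_weight N] by metis
qed

text \<open>The minimum in the regularity condition ranges over all sign patterns around the root, among them
  the labels of the representative by which the minimum is evaluated. No invariance of the minimum
  itself is needed.\<close>

lemma regular_field_bound:
  assumes N: "connected_network N" "i \<in> verts N"
    and reg: "\<epsilon> \<le> on_class (\<lambda>N i. Min ((\<lambda>x. \<bar>\<Sum>j\<in>nbrs N i. x j * weight N i j\<bar>)
                              ` (nbrs N i \<rightarrow>\<^sub>E {-1, 1 :: real}))) (iso_class N [i])"
  shows "\<epsilon> \<le> \<bar>\<Sum>u\<in>nbrs N i. label N u * weight N i u\<bar>"
proof -
  have v: "valid_roots N [i]" using N by (auto simp: valid_roots_def)
  obtain N' h where x: "(SOME x. x \<in> iso_class N [i]) = (N', map h [i])"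
    "connected_network N'" "network_iso h N N'"
    by (rule iso_classE[OF some_in_iso_class[OF N(1), of "[i]"]])
  define i' where "i' = h i"
  have i': "i' \<in> verts N'"
    using x(3) N(2) by (auto simp: network_iso_def bij_betw_def i'_def)
  define y where "y = restrict (label N') (nbrs N' i')"
  have fin: "finite (nbrs N' i')" by (rule finite_nbrs[OF x(2) i'])
  have "\<epsilon> \<le> Min ((\<lambda>x. \<bar>\<Sum>j\<in>nbrs N' i'. x j * weight N' i' j\<bar>) ` (nbrs N' i' \<rightarrow>\<^sub>E {-1, 1 :: real}))"
    using reg x(1) by (simp add: on_class_def i'_def)
  also have "\<dots> \<le> \<bar>\<Sum>j\<in>nbrs N' i'. y j * weight N' i' j\<bar>"
  proof (rule Min_le)
    show "finite ((\<lambda>x. \<bar>\<Sum>j\<in>nbrs N' i'. x j * weight N' i' j\<bar>) ` (nbrs N' i' \<rightarrow>\<^sub>E {-1, 1 :: real}))"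
      using fin by (intro finite_imageI finite_PiE) auto
    have "y \<in> nbrs N' i' \<rightarrow>\<^sub>E {-1, 1}"
      using label_cases[OF x(2)] edges_verts[OF x(2)] by (auto simp: y_def nbrs_def)
    then show "\<bar>\<Sum>j\<in>nbrs N' i'. y j * weight N' i' j\<bar> \<in>
        (\<lambda>x. \<bar>\<Sum>j\<in>nbrs N' i'. x j * weight N' i' j\<bar>) ` (nbrs N' i' \<rightarrow>\<^sub>E {-1, 1 :: real})"
      by (rule imageI)
  qed
  also have "(\<Sum>j\<in>nbrs N' i'. y j * weight N' i' j) = root_field (N', map h [i])"
    by (auto simp: root_field_def y_def i'_def intro!: sum.cong)
  also have "\<dots> = root_field (N, [i])"
    by (rule iso_invariantD[OF iso_invariant_root_field N(1) x(2,3) v])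
  finally show ?thesis by (simp add: root_field_def)
qed

section \<open>Monotonicity of the energy\<close>

text \<open>Superadditivity of the upward approximation by simple functions, for functions that need not be
  measurable.\<close>

lemma nn_integral_superadditive:
  fixes f g :: "'a \<Rightarrow> ennreal"
  shows "(\<integral>\<^sup>+ x. f x \<partial>M) + (\<integral>\<^sup>+ x. g x \<partial>M) \<le> (\<integral>\<^sup>+ x. f x + g x \<partial>M)"
proof -
  have *: "integral\<^sup>S M u + integral\<^sup>S M v \<le> (\<integral>\<^sup>+ x. f x + g x \<partial>M)"
    if "simple_function M u" "u \<le> f" "simple_function M v" "v \<le> g" for u v
  proof -
    have "integral\<^sup>S M u + integral\<^sup>S M v = (\<integral>\<^sup>+ x. u x + v x \<partial>M)"
      using that by (simp add: nn_integral_add nn_integral_eq_simple_integral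
          borel_measurable_simple_function)
    also have "\<dots> \<le> (\<integral>\<^sup>+ x. f x + g x \<partial>M)"
      using that by (auto simp: le_fun_def intro!: nn_integral_mono add_mono)
    finally show ?thesis .
  qed
  have ne: "{u. simple_function M u \<and> u \<le> f} \<noteq> {}" for f :: "'a \<Rightarrow> ennreal"
    by (auto intro!: exI[of _ "\<lambda>_. 0"] simp: le_fun_def)
  have "integral\<^sup>S M u + (\<integral>\<^sup>+ x. g x \<partial>M) \<le> (\<integral>\<^sup>+ x. f x + g x \<partial>M)"
    if "simple_function M u" "u \<le> f" for u
    unfolding nn_integral_def[of M g] using that *
    by (subst ennreal_SUP_add_right[OF ne]) (auto intro!: SUP_least)
  then show ?thesis
    unfolding nn_integral_def[of M f]
    by (subst ennreal_SUP_add_left[symmetric, OF ne]) (auto intro!: SUP_least)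
qed

text \<open>A single realization of the dynamics: \<open>c t\<close> is the class of the network \<open>N\<close> with labels \<open>X t\<close> and
  root \<open>i\<close>, and the labels follow the majority rule.\<close>

definition majority_orbit ::
  "network \<Rightarrow> nat \<Rightarrow> (nat \<Rightarrow> nat \<Rightarrow> real) \<Rightarrow> (nat \<Rightarrow> net_class) \<Rightarrow> bool" where
  "majority_orbit N i X c \<longleftrightarrow>
     i \<in> verts N \<and>
     (\<forall>t. connected_network (N\<lparr>label := X t\<rparr>) \<and> c t = iso_class (N\<lparr>label := X t\<rparr>) [i]) \<and>
     (\<forall>t. \<forall>v\<in>verts N. X (Suc t) v = sgn (\<Sum>u\<in>nbrs N v. X t u * weight N v u))"

lemma majority_dynamics_orbit:
  assumes "majority_dynamics M Z"
  shows "AE \<omega> in M. \<exists>N i X. majority_orbit N i X (\<lambda>t. Z t \<omega>)"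
  using assms unfolding majority_dynamics_def
proof (rule AE_mp, intro AE_I2 impI)
  fix \<omega> assume "\<exists>N i. \<exists>X :: nat \<Rightarrow> nat \<Rightarrow> real. i \<in> verts N \<and>
        (\<forall>t. connected_network (N\<lparr>label := X t\<rparr>) \<and> Z t \<omega> = iso_class (N\<lparr>label := X t\<rparr>) [i]) \<and>
        (\<forall>t>0. \<forall>v\<in>verts N.
           (\<Sum>u\<in>nbrs N v. X (t - 1) u * weight N v u) \<noteq> 0 \<and>
           X t v = sgn (\<Sum>u\<in>nbrs N v. X (t - 1) u * weight N v u))"
  then obtain N i X where "i \<in> verts N"
    "\<forall>t. connected_network (N\<lparr>label := X t\<rparr>) \<and> Z t \<omega> = iso_class (N\<lparr>label := X t\<rparr>) [i]"
    and r: "\<forall>t>0. \<forall>v\<in>verts N. X t v = sgn (\<Sum>u\<in>nbrs N v. X (t - 1) u * weight N v u)"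
    by blast
  moreover have "\<forall>t. \<forall>v\<in>verts N. X (Suc t) v = sgn (\<Sum>u\<in>nbrs N v. X t u * weight N v u)"
    using r[rule_format, of "Suc _"] by simp
  ultimately show "\<exists>N i X. majority_orbit N i X (\<lambda>t. Z t \<omega>)"
    unfolding majority_orbit_def by blast
qed

context
  fixes N :: network and i :: nat and X :: "nat \<Rightarrow> nat \<Rightarrow> real" and c :: "nat \<Rightarrow> net_class"
  assumes orbit: "majority_orbit N i X c"
begin

lemma orbit_connected: "connected_network (N\<lparr>label := X t\<rparr>)"
  and orbit_class: "c t = iso_class (N\<lparr>label := X t\<rparr>) [i]"
  and orbit_root: "i \<in> verts N"
  and orbit_step: "v \<in> verts N \<Longrightarrow> X (Suc t) v = sgn (\<Sum>u\<in>nbrs N v. X t u * weight N v u)"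
  using orbit by (auto simp: majority_orbit_def)

lemma nbrs_update_label: "nbrs (N\<lparr>label := Y\<rparr>) v = nbrs N v"
  by (simp add: nbrs_def)

lemma orbit_label: "v \<in> verts N \<Longrightarrow> X t v = -1 \<or> X t v = 1"
  using label_cases[OF orbit_connected[of t], of v] by simp

lemma orbit_nbr:
  assumes "j \<in> nbrs N i"
  shows "j \<in> verts N" "i \<in> nbrs N j" "weight N j i = weight N i j" "0 \<le> weight N i j"
proof -
  have e: "(i, j) \<in> edges (N\<lparr>label := X 0\<rparr>)" using assms by (simp add: nbrs_def)
  show "j \<in> verts N" "i \<in> nbrs N j" "weight N j i = weight N i j" "0 \<le> weight N i j"
    using edges_verts(2)[OF orbit_connected e] edges_commute[OF orbit_connected e]
    by (simp_all add: nbrs_def)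
qed

lemma orbit_root_label: "root_label (c t) = X t i"
  unfolding root_label_def on_class_eq orbit_class
  by (subst class_value_iso_class[OF iso_invariant_label_hd orbit_connected])
     (auto simp: valid_roots_def orbit_root)

lemma orbit_total_weight:
  "on_class (\<lambda>N i. \<Sum>j\<in>nbrs N i. weight N i j) (c t) = (\<Sum>j\<in>nbrs N i. weight N i j)"
  unfolding orbit_class using total_weight_eq[OF orbit_connected[of t], of i] orbit_root
  by (simp add: nbrs_update_label)

lemma orbit_weight_agreement_nonneg:
  "j \<in> nbrs N i \<Longrightarrow> 0 \<le> weight N i j * (1 + X s i * X t j) / 2"
  using orbit_nbr[of j] orbit_label[OF orbit_root, of s] orbit_label[of j t] by auto

lemma orbit_outgoing_agreement:
  "outgoing_agreement (c t) = ennreal (\<Sum>j\<in>nbrs N i. weight N i j * (1 + X (Suc t) i * X t j) / 2)"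
proof -
  have "outgoing_agreement (c t) =
      (\<Sum>j\<in>nbrs N i. ennreal (edge_agreement (N\<lparr>label := X t\<rparr>, [i, j])))"
    unfolding orbit_class using outgoing_agreement_eq[OF orbit_connected[of t], of i] orbit_root
    by (simp add: nbrs_update_label)
  also have "\<dots> = (\<Sum>j\<in>nbrs N i. ennreal (weight N i j * (1 + X (Suc t) i * X t j) / 2))"
  proof (intro sum.cong refl)
    fix j assume "j \<in> nbrs N i"
    then have "(i, j) \<in> edges (N\<lparr>label := X t\<rparr>)" by (simp add: nbrs_def)
    then show "ennreal (edge_agreement (N\<lparr>label := X t\<rparr>, [i, j])) =
        ennreal (weight N i j * (1 + X (Suc t) i * X t j) / 2)"
      by (simp add: edge_agreement_edge nbrs_update_label orbit_step[OF orbit_root])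
  qed
  also have "\<dots> = ennreal (\<Sum>j\<in>nbrs N i. weight N i j * (1 + X (Suc t) i * X t j) / 2)"
    by (rule sum_ennreal) (rule orbit_weight_agreement_nonneg)
  finally show ?thesis .
qed

lemma orbit_incoming_agreement:
  "incoming_agreement (c t) = ennreal (\<Sum>j\<in>nbrs N i. weight N i j * (1 + X t i * X (Suc t) j) / 2)"
proof -
  have "incoming_agreement (c t) =
      (\<Sum>j\<in>nbrs N i. ennreal (edge_agreement (N\<lparr>label := X t\<rparr>, [j, i])))"
    unfolding orbit_class using incoming_agreement_eq[OF orbit_connected[of t], of i] orbit_root
    by (simp add: nbrs_update_label)
  also have "\<dots> = (\<Sum>j\<in>nbrs N i. ennreal (weight N i j * (1 + X t i * X (Suc t) j) / 2))"
  proof (intro sum.cong refl)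
    fix j assume j: "j \<in> nbrs N i"
    then have "(j, i) \<in> edges (N\<lparr>label := X t\<rparr>)" using orbit_nbr by (simp add: nbrs_def)
    then show "ennreal (edge_agreement (N\<lparr>label := X t\<rparr>, [j, i])) =
        ennreal (weight N i j * (1 + X t i * X (Suc t) j) / 2)"
      using orbit_nbr[OF j]
      by (simp add: edge_agreement_edge nbrs_update_label orbit_step mult.commute)
  qed
  also have "\<dots> = ennreal (\<Sum>j\<in>nbrs N i. weight N i j * (1 + X t i * X (Suc t) j) / 2)"
    by (rule sum_ennreal) (rule orbit_weight_agreement_nonneg)
  finally show ?thesis .
qed

lemma orbit_outgoing_agreement_le:
  "outgoing_agreement (c t) \<le> ennreal (on_class (\<lambda>N i. \<Sum>j\<in>nbrs N i. weight N i j) (c t))"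
  unfolding orbit_outgoing_agreement orbit_total_weight
proof (intro ennreal_leI sum_mono)
  fix j assume j: "j \<in> nbrs N i"
  show "weight N i j * (1 + X (Suc t) i * X t j) / 2 \<le> weight N i j"
    using orbit_nbr[OF j] orbit_label[OF orbit_root, of "Suc t"] orbit_label[of j t] by auto
qed

text \<open>The energy gain: \<open>incoming_agreement\<close> at time \<open>t\<close> and \<open>outgoing_agreement\<close> at time \<open>t + 1\<close> pair the
  same labels \<open>X (t + 1)\<close> of the neighbors with the labels of the root at the times \<open>t\<close> and \<open>t + 2\<close>.\<close>

lemma orbit_agreement_gain:
  assumes reg: "\<epsilon> \<le> on_class (\<lambda>N i. Min ((\<lambda>x. \<bar>\<Sum>j\<in>nbrs N i. x j * weight N i j\<bar>)
                              ` (nbrs N i \<rightarrow>\<^sub>E {-1, 1 :: real}))) (c (Suc t))"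
    and "0 < \<epsilon>"
  shows "incoming_agreement (c t) + ennreal \<epsilon> * of_bool (root_label (c (t + 2)) \<noteq> root_label (c t))
    \<le> outgoing_agreement (c (Suc t))"
proof -
  define s where "s = (\<Sum>u\<in>nbrs N i. X (Suc t) u * weight N i u)"
  have s: "\<epsilon> \<le> \<bar>s\<bar>"
    using regular_field_bound[OF orbit_connected[of "Suc t"] _ reg[unfolded orbit_class]] orbit_root
    by (simp add: s_def nbrs_update_label)
  have X2: "X (Suc (Suc t)) i = sgn s" using orbit_step[OF orbit_root] by (simp add: s_def)
  have energy: "(\<Sum>j\<in>nbrs N i. weight N i j * (1 + a * X (Suc t) j) / 2)
      = (\<Sum>j\<in>nbrs N i. weight N i j) / 2 + a * s / 2" for a
  proof -
    have "weight N i j * (1 + a * X (Suc t) j) / 2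
        = weight N i j / 2 + a * (X (Suc t) j * weight N i j) / 2" for j
      by (simp add: field_simps)
    then show ?thesis
      by (simp only: s_def sum.distrib sum_divide_distrib sum_distrib_left)
  qed
  define b where "b = (if X (Suc (Suc t)) i \<noteq> X t i then \<epsilon> else 0)"
  have "X t i * s / 2 + b \<le> X (Suc (Suc t)) i * s / 2"
    using orbit_label[OF orbit_root, of t]
  proof
    assume "X t i = -1"
    with s \<open>0 < \<epsilon>\<close> show ?thesis by (cases "0 < s") (simp_all add: b_def X2)
  next
    assume "X t i = 1"
    with s \<open>0 < \<epsilon>\<close> show ?thesis by (cases "0 < s") (simp_all add: b_def X2 sgn_if)
  qed
  then have le: "(\<Sum>j\<in>nbrs N i. weight N i j * (1 + X t i * X (Suc t) j) / 2) + b
      \<le> (\<Sum>j\<in>nbrs N i. weight N i j * (1 + X (Suc (Suc t)) i * X (Suc t) j) / 2)"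
    unfolding energy by simp
  have nn: "0 \<le> (\<Sum>j\<in>nbrs N i. weight N i j * (1 + X t i * X (Suc t) j) / 2)"
    by (rule sum_nonneg) (rule orbit_weight_agreement_nonneg)
  have b: "ennreal \<epsilon> * of_bool (root_label (c (t + 2)) \<noteq> root_label (c t)) = ennreal b" "0 \<le> b"
    using \<open>0 < \<epsilon>\<close> by (auto simp: b_def orbit_root_label)
  show ?thesis
    unfolding b(1) orbit_incoming_agreement orbit_outgoing_agreement
      ennreal_plus[OF nn b(2), symmetric]
    by (rule ennreal_leI[OF le])
qed

end

theorem theorem4:
  fixes M :: "'a measure" and Z :: "nat \<Rightarrow> 'a \<Rightarrow> net_class" and \<epsilon> W :: real
  assumes "0 < \<epsilon>" and "0 < W"
    and "\<And>t. random_network M (Z t)"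
    and "\<And>t. unimodular M (Z t)"
    and "\<And>t. regular_network \<epsilon> W M (Z t)"
    and "majority_dynamics M Z"
  shows "measure M {\<omega> \<in> space M.
           (\<lambda>t. root_label (Z (t + 2) \<omega>) - root_label (Z t \<omega>)) \<longlonglongrightarrow> 0} = 1 \<and>
         (\<integral>\<^sup>+ \<omega>. emeasure (count_space UNIV)
           {t. root_label (Z (t + 2) \<omega>) \<noteq> root_label (Z t \<omega>)} \<partial>M) \<le> ennreal (2 * W / \<epsilon>)"
proof -
  interpret prob_space M using assms(3) by (auto simp: random_network_def)
  have [measurable]: "(\<lambda>\<omega>. root_label (Z t \<omega>)) \<in> borel_measurable M" for t
    using measurable_compose[OF _ root_label_measurable, of "Z t" M] assms(3)
    by (auto simp: random_network_def)
  \<comment> \<open>The event that the label of the root at time \<open>t + 2\<close> differs from that at time \<open>t\<close>.\<close>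
  define D where "D t \<omega> \<longleftrightarrow> root_label (Z (t + 2) \<omega>) \<noteq> root_label (Z t \<omega>)" for t \<omega>
  have [measurable]: "Measurable.pred M (D t)" for t unfolding D_def by measurable
  note orbits = majority_dynamics_orbit[OF assms(6)]
  define E where "E t = (\<integral>\<^sup>+ \<omega>. outgoing_agreement (Z t \<omega>) \<partial>M)" for t
  have E_le: "E t \<le> ennreal W" for t
  proof -
    have "AE \<omega> in M. outgoing_agreement (Z t \<omega>) \<le>
        ennreal (on_class (\<lambda>N i. \<Sum>j\<in>nbrs N i. weight N i j) (Z t \<omega>))"
      using orbits by eventually_elim (auto dest: orbit_outgoing_agreement_le)
    then have "E t \<le> (\<integral>\<^sup>+ \<omega>. ennreal (on_class (\<lambda>N i. \<Sum>j\<in>nbrs N i. weight N i j) (Z t \<omega>)) \<partial>M)"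
      unfolding E_def by (rule nn_integral_mono_AE)
    also have "\<dots> \<le> ennreal W" using assms(5)[of t] by (simp add: regular_network_def)
    finally show ?thesis .
  qed
  have E_step: "E t + (\<integral>\<^sup>+ \<omega>. ennreal \<epsilon> * of_bool (D t \<omega>) \<partial>M) \<le> E (Suc t)" for t
  proof -
    have reg: "AE \<omega> in M. \<epsilon> \<le> on_class (\<lambda>N i. Min ((\<lambda>x. \<bar>\<Sum>j\<in>nbrs N i. x j * weight N i j\<bar>)
        ` (nbrs N i \<rightarrow>\<^sub>E {-1, 1 :: real}))) (Z (Suc t) \<omega>)"
      using assms(5)[of "Suc t"] by (simp add: regular_network_def)
    have "E t + (\<integral>\<^sup>+ \<omega>. ennreal \<epsilon> * of_bool (D t \<omega>) \<partial>M)
        = (\<integral>\<^sup>+ \<omega>. incoming_agreement (Z t \<omega>) \<partial>M) + (\<integral>\<^sup>+ \<omega>. ennreal \<epsilon> * of_bool (D t \<omega>) \<partial>M)"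
      using nn_integral_agreement[OF assms(4)] by (simp add: E_def)
    \<comment> \<open>Superadditivity makes the measurability of \<open>incoming_agreement\<close> unnecessary.\<close>
    also have "\<dots> \<le> (\<integral>\<^sup>+ \<omega>. incoming_agreement (Z t \<omega>) + ennreal \<epsilon> * of_bool (D t \<omega>) \<partial>M)"
      by (rule nn_integral_superadditive)
    also have "\<dots> \<le> E (Suc t)"
      unfolding E_def
    proof (rule nn_integral_mono_AE)
      show "AE \<omega> in M. incoming_agreement (Z t \<omega>) + ennreal \<epsilon> * of_bool (D t \<omega>)
          \<le> outgoing_agreement (Z (Suc t) \<omega>)"
        using orbits reg
      proof eventually_elim
        case (elim \<omega>)
        then obtain N i X where "majority_orbit N i X (\<lambda>t. Z t \<omega>)" by blast
        from orbit_agreement_gain[OF this elim(2) assms(1)] show ?case by (simp add: D_def)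
      qed
    qed
    finally show ?thesis .
  qed
  have partial: "(\<Sum>t<n. \<integral>\<^sup>+ \<omega>. ennreal \<epsilon> * of_bool (D t \<omega>) \<partial>M) \<le> E n" for n
  proof (induction n)
    case (Suc n)
    then show ?case using E_step[of n] by (auto intro: order_trans[OF add_right_mono])
  qed simp
  \<comment> \<open>The number of changes, as a sum of indicators.\<close>
  define C where "C \<omega> = (\<Sum>t. of_bool (D t \<omega>) :: ennreal)" for \<omega>
  have C: "emeasure (count_space UNIV) {t. root_label (Z (t + 2) \<omega>) \<noteq> root_label (Z t \<omega>)} = C \<omega>"
    for \<omega>
  proof -
    have "C \<omega> = (\<integral>\<^sup>+ t. indicator {t. D t \<omega>} t \<partial>count_space UNIV)"
      by (simp add: C_def nn_integral_count_space_nat indicator_def)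
    also have "\<dots> = emeasure (count_space UNIV) {t. D t \<omega>}" by simp
    finally show ?thesis by (simp add: D_def)
  qed
  have [measurable]: "C \<in> borel_measurable M" unfolding C_def by measurable
  have "ennreal \<epsilon> * (\<integral>\<^sup>+ \<omega>. C \<omega> \<partial>M) = (\<Sum>t. \<integral>\<^sup>+ \<omega>. ennreal \<epsilon> * of_bool (D t \<omega>) \<partial>M)"
    unfolding C_def by (simp add: nn_integral_suminf nn_integral_cmult)
  also have "\<dots> \<le> ennreal W"
    by (rule suminf_le_const) (auto intro: order_trans[OF partial E_le])
  finally have le: "ennreal \<epsilon> * (\<integral>\<^sup>+ \<omega>. C \<omega> \<partial>M) \<le> ennreal W" .
  have "(\<integral>\<^sup>+ \<omega>. C \<omega> \<partial>M) = ennreal (1 / \<epsilon>) * (ennreal \<epsilon> * (\<integral>\<^sup>+ \<omega>. C \<omega> \<partial>M))"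
    using assms(1) by (simp add: mult.assoc[symmetric] ennreal_mult[symmetric])
  also have "\<dots> \<le> ennreal (1 / \<epsilon>) * ennreal W" by (rule mult_left_mono[OF le]) simp
  also have "\<dots> = ennreal (W / \<epsilon>)" using assms(1,2) by (simp add: ennreal_mult[symmetric])
  finally have bound: "(\<integral>\<^sup>+ \<omega>. C \<omega> \<partial>M) \<le> ennreal (W / \<epsilon>)" .
  have "AE \<omega> in M. C \<omega> \<noteq> \<infinity>"
    using bound by (intro nn_integral_PInf_AE) (auto simp: top_unique)
  then have lim: "AE \<omega> in M. (\<lambda>t. root_label (Z (t + 2) \<omega>) - root_label (Z t \<omega>)) \<longlonglongrightarrow> 0"
  proof eventually_elim
    case (elim \<omega>)
    then have "finite {t. root_label (Z (t + 2) \<omega>) \<noteq> root_label (Z t \<omega>)}"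
      unfolding C[symmetric] by (auto simp: emeasure_count_space split: if_splits)
    \<comment> \<open>A property that fails only finitely often holds eventually.\<close>
    then have "eventually (\<lambda>t. root_label (Z (t + 2) \<omega>) - root_label (Z t \<omega>) = 0) sequentially"
      by (simp add: cofinite_eq_sequentially[symmetric] eventually_cofinite)
    then show ?case by (rule tendsto_eventually)
  qed
  have "prob {\<omega> \<in> space M. (\<lambda>t. root_label (Z (t + 2) \<omega>) - root_label (Z t \<omega>)) \<longlonglongrightarrow> 0} = 1"
    using lim by (subst prob_Collect_eq_1) measurable
  moreover have "W / \<epsilon> \<le> 2 * W / \<epsilon>" using assms(1,2) by (simp add: field_simps)
  then have "(\<integral>\<^sup>+ \<omega>. C \<omega> \<partial>M) \<le> ennreal (2 * W / \<epsilon>)"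
    using bound ennreal_leI order_trans by blast
  ultimately show ?thesis unfolding C by blast
qed

end
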